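(* Let $d>k\ge 1$ be integers, $p>1$, and let $a,b,\gamma\in\mathbb{R}$ satisfy $$k+a>0,\qquad d+a-p>b,\qquad k+a-p>b-\gamma .$$ Let $S_{b,\gamma}$ be the best (largest) constant in the inequality $$S_{b,\gamma}\int_{\mathbb{R}^d}|y|^{a-p-b+\gamma}|z|^{-\gamma}|u|^p\,dz\le\int_{\mathbb{R}^d}|y|^{a}|z|^{-b}|\nabla u|^p\,dz\qquad\text{for all }u\in C^\infty_c(\mathbb{R}^d).$$ Then $S_{b,\gamma}>0$ if and only if $\gamma\ge b$.
   Context: Write $\mathbb{R}^d\equiv\mathbb{R}^k\times\mathbb{R}^{d-k}\ni (y,x)\equiv z$, so $y\in\mathbb{R}^k$ denotes the first $k$ coordinates of $z$. Equivalently, $S_{b,\gamma}$ is the infimum, over $u\in C_c^\infty(\mathbb{R}^d)\setminus\{0\}$, of the quotient $\int_{\mathbb{R}^d}|y|^{a}|z|^{-b}|\nabla u|^p\,dz\big/\int_{\mathbb{R}^d}|y|^{a-p-b+\gamma}|z|^{-\gamma}|u|^p\,dz$; the conditions on $a,b,\gamma$ guarantee that the weights are locally integrable. *)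

theory Defs
  imports "HOL-Analysis.Analysis"
begin

primrec continuously_differentiable :: "nat \<Rightarrow> ('a::euclidean_space \<Rightarrow> real) \<Rightarrow> bool" where
  "continuously_differentiable 0 u \<longleftrightarrow> continuous_on UNIV u"
| "continuously_differentiable (Suc n) u \<longleftrightarrow>
     u differentiable_on UNIV \<and>
     (\<forall>v. continuously_differentiable n (\<lambda>z. frechet_derivative u (at z) v))"

definition smooth_compactly_supported :: "('a::euclidean_space \<Rightarrow> real) set" where
  "smooth_compactly_supported =
     {u. (\<forall>n. continuously_differentiable n u) \<and> compact (closure {z. u z \<noteq> 0})}"

definition gradient :: "('a::euclidean_space \<Rightarrow> real) \<Rightarrow> 'a \<Rightarrow> 'a" where
  "gradient u z = (\<Sum>e\<in>Basis. frechet_derivative u (at z) e *\<^sub>R e)"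

lemma gderiv_gradient:
  assumes "u differentiable (at z)"
  shows "GDERIV u z :> gradient u z"
proof -
  let ?D = "frechet_derivative u (at z)"
  have D: "(u has_derivative ?D) (at z)"
    using assms by (simp add: frechet_derivative_works)
  then interpret linear ?D
    by (rule has_derivative_linear)
  have "?D h = h \<bullet> gradient u z" for h
  proof -
    have "?D h = ?D (\<Sum>e\<in>Basis. (h \<bullet> e) *\<^sub>R e)"
      by (simp add: euclidean_representation)
    also have "\<dots> = (\<Sum>e\<in>Basis. (h \<bullet> e) * ?D e)"
      by (simp add: sum scale)
    finally show ?thesis
      by (simp add: gradient_def inner_sum_right mult.commute)
  qed
  then have "?D = (\<lambda>h. h \<bullet> gradient u z)"
    by (rule ext)
  with D show ?thesis
    by (simp add: gderiv_def)
qed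

text \<open>
  A point of $\mathbb{R}^d = \mathbb{R}^k \times \mathbb{R}^{d-k}$ is a pair \<open>z = (y, x)\<close> with
  \<open>y = fst z\<close>; the product norm is the Euclidean one. Both integrals have nonnegative integrands
  and take values in $[0,\infty]$. The convention \<open>0 powr s = 0\<close> affects the weights only on the
  null set \<open>y = 0\<close>.
\<close>

definition potential_integral ::
  "real \<Rightarrow> real \<Rightarrow> real \<Rightarrow> real \<Rightarrow> ((real^'k) \<times> (real^'m) \<Rightarrow> real) \<Rightarrow> ennreal" where
  "potential_integral p a b \<gamma> u =
     (\<integral>\<^sup>+z. ennreal (norm (fst z) powr (a - p - b + \<gamma>) * norm z powr (- \<gamma>) * \<bar>u z\<bar> powr p) \<partial>lborel)"

definition gradient_integral ::
  "real \<Rightarrow> real \<Rightarrow> real \<Rightarrow> ((real^'k) \<times> (real^'m) \<Rightarrow> real) \<Rightarrow> ennreal" where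
  "gradient_integral p a b u =
     (\<integral>\<^sup>+z. ennreal (norm (fst z) powr a * norm z powr (- b) * norm (gradient u z) powr p) \<partial>lborel)"

definition admissible_constant ::
  "'k::finite itself \<Rightarrow> 'm::finite itself \<Rightarrow> real \<Rightarrow> real \<Rightarrow> real \<Rightarrow> real \<Rightarrow> ennreal \<Rightarrow> bool" where
  "admissible_constant _ _ p a b \<gamma> S \<longleftrightarrow>
     (\<forall>u \<in> (smooth_compactly_supported :: ((real^'k) \<times> (real^'m) \<Rightarrow> real) set).
        S * potential_integral p a b \<gamma> u \<le> gradient_integral p a b u)"

definition best_constant ::
  "'k::finite itself \<Rightarrow> 'm::finite itself \<Rightarrow> real \<Rightarrow> real \<Rightarrow> real \<Rightarrow> real \<Rightarrow> ennreal" where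
  "best_constant K M p a b \<gamma> = Sup {S. admissible_constant K M p a b \<gamma> S}"

lemma admissible_best_constant: "admissible_constant K M p a b \<gamma> (best_constant K M p a b \<gamma>)"
proof -
  have Sup_mult: "Sup A * c \<le> e" if "\<And>S. S \<in> A \<Longrightarrow> S * c \<le> e" for A and c e :: ennreal
    using that SUP_mult_right_ennreal[of "\<lambda>S. S" A c] by (auto intro: SUP_least)
  show ?thesis
    unfolding best_constant_def admissible_constant_def
    by (intro ballI Sup_mult) auto
qed

lemma admissible_le_best_constant:
  "admissible_constant K M p a b \<gamma> S \<Longrightarrow> S \<le> best_constant K M p a b \<gamma>"
  unfolding best_constant_def by (auto intro: Sup_upper)

end

theory Submission
  imports Defs
begin

text \<open>
  For \<open>\<gamma> \<ge> b\<close> the inequality follows, after a reduction to \<open>\<gamma> = b\<close>, from the cylindrical Hardy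
  inequality \<open>weighted_Hardy\<close>, which bounds
  \<open>\<integral> \<bar>y\<bar> powr \<alpha> \<bar>z\<bar> powr (- b) \<bar>u\<bar>\<^sup>p\<close> by a multiple of
  \<open>\<integral> \<bar>y\<bar> powr (\<alpha> + p) \<bar>z\<bar> powr (- b) \<bar>\<nabla>u\<bar>\<^sup>p\<close> whenever \<open>k + \<alpha> > 0\<close> and \<open>d + \<alpha> - b > 0\<close>.
  Such inequalities are usually derived from the divergence theorem applied to a singular vector
  field built from \<open>y\<close> and \<open>z\<close>. Here the flows of these two fields, that is, the
  dilations \<open>(y, x) \<mapsto> (t y, x)\<close> and \<open>z \<mapsto> t z\<close>, are used directly. If the substitution of a
  dilation by 2 contracts the weighted norm, then \<open>u\<close> differs so much from its dilate that its norm
  is controlled by the norm of the difference, and the difference is an integral of the derivative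
  of \<open>u\<close> along the dilation (\<open>dilation_Hardy\<close>). The condition \<open>d + \<alpha> - b > 0\<close> makes
  the full dilation contract, which is enough on a cone where \<open>\<bar>y\<bar>\<close> and \<open>\<bar>z\<bar>\<close> are comparable.
  The condition \<open>k + \<alpha> > 0\<close> makes the partial dilation contract near \<open>y = 0\<close>, where the
  factor \<open>\<bar>z\<bar> powr (- b)\<close> hardly changes.

  For \<open>\<gamma> < b\<close>, bump functions of radius \<open>r\<close> at distance \<open>2 r\<close> from the singular set, near a fixed
  point \<open>(0, x\<^sub>0)\<close> with \<open>x\<^sub>0 \<noteq> 0\<close>, have quotient of order \<open>r powr (b - \<gamma>)\<close>, so no
  positive constant is admissible (\<open>best_constant_zero\<close>).
\<close>

section \<open>Elementary inequalities for powers\<close>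

text \<open>
  This replaces Minkowski's inequality: the constant in front of \<open>t\<close> may be as close to 1 as one
  likes, which is what makes absorption possible later. Either \<open>\<bar>t\<bar> \<ge> q \<bar>s\<bar>\<close>, and the first term
  suffices, or \<open>\<bar>s - t\<bar> \<ge> (1 - q) \<bar>s\<bar>\<close>, and the second one does; \<open>q\<close> is the root of
  \<open>c q\<^sup>p = 1\<close>.
\<close>
lemma powr_le_combination:
  fixes p c :: real
  assumes "p > 0" "c > 1"
  shows "\<exists>K>0. \<forall>s t. \<bar>s\<bar> powr p \<le> c * \<bar>t\<bar> powr p + K * \<bar>s - t\<bar> powr p"
proof -
  define q where "q = c powr (-1/p)"
  have q: "0 < q" "q < 1"
    using assms powr_less_mono[of "-1/p" 0 c] by (auto simp: q_def)
  have "q powr p = c powr (-1)"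
    using assms by (simp add: q_def powr_powr)
  then have qp: "c * q powr p = 1"
    using assms by (simp add: powr_minus)
  show ?thesis
  proof (intro exI[of _ "(1 - q) powr (- p)"] conjI allI)
    fix s t :: real
    show "\<bar>s\<bar> powr p \<le> c * \<bar>t\<bar> powr p + (1 - q) powr (- p) * \<bar>s - t\<bar> powr p"
    proof (cases "q * \<bar>s\<bar> \<le> \<bar>t\<bar>")
      case True
      have "\<bar>s\<bar> powr p = c * (q * \<bar>s\<bar>) powr p"
        using qp by (simp add: powr_mult)
      also have "\<dots> \<le> c * \<bar>t\<bar> powr p"
        using True assms q by (intro mult_left_mono powr_mono2) auto
      finally show ?thesis
        by (rule add_increasing2[rotated]) simp
    next
      case False
      have "\<bar>s\<bar> powr p = (1 - q) powr (- p) * ((1 - q) * \<bar>s\<bar>) powr p"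
        using q by (simp add: powr_mult powr_minus)
      also have "\<dots> \<le> (1 - q) powr (- p) * \<bar>s - t\<bar> powr p"
        using False assms q
        by (intro mult_left_mono powr_mono2) (auto simp: algebra_simps mult_left_le_one_le)
      finally show ?thesis
        by (rule add_increasing[rotated]) (use assms in simp)
    qed
  qed (use q in auto)
qed

text \<open>
  Jensen's inequality for the increment over an interval of length one. With \<open>c\<close> the size of the
  increment, Young's inequality gives
  \<open>\<bar>h'\<bar> c powr (p - 1) \<le> \<bar>h'\<bar> powr p / p + (1 - 1/p) c powr p\<close> pointwise. Integrating, the left side
  becomes at least \<open>c powr p\<close>, and the last term is absorbed.
\<close>
lemma increment_powr_le_nn_integral:
  fixes h h' :: "real \<Rightarrow> real" and p :: real
  assumes p: "p > 1"
    and h: "\<And>t. t \<in> {1..2} \<Longrightarrow> (h has_real_derivative h' t) (at t within {1..2})"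
    and cont: "continuous_on {1..2} h'"
  shows "ennreal (\<bar>h 2 - h 1\<bar> powr p) \<le> (\<integral>\<^sup>+t. ennreal (\<bar>h' t\<bar> powr p) * indicator {1..2} t \<partial>lborel)"
proof -
  define c where "c = \<bar>h 2 - h 1\<bar>"
  define J where "J = integral {1..2} (\<lambda>t. \<bar>h' t\<bar> powr p)"
  have int_p: "((\<lambda>t. \<bar>h' t\<bar> powr p) has_integral J) {1..2}"
    unfolding J_def using cont p
    by (intro integrable_integral integrable_continuous_real continuous_on_powr' continuous_intros) auto
  have int_1: "((\<lambda>t. \<bar>h' t\<bar>) has_integral integral {1..2} (\<lambda>t. \<bar>h' t\<bar>)) {1..2}"
    using cont by (intro integrable_integral integrable_continuous_real continuous_intros) auto
  have "(h' has_integral (h 2 - h 1)) {1..2}"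
    using h by (intro fundamental_theorem_of_calculus) (auto simp: has_real_derivative_iff_has_vector_derivative)
  then have c_le: "c \<le> integral {1..2} (\<lambda>t. \<bar>h' t\<bar>)"
    unfolding c_def using integral_norm_bound_integral[of h' "{1..2}" "\<lambda>t. \<bar>h' t\<bar>"] int_1
    by (auto simp: has_integral_iff)
  have conj: "1/p + 1/(p/(p-1)) = 1" "p/(p-1) > 1" "(p-1)*(p/(p-1)) = p"
    "x / (p/(p-1)) = x * (1 - 1/p)" for x
    using p by (auto simp: field_simps)
  have young: "\<bar>h' t\<bar> * c powr (p-1) \<le> \<bar>h' t\<bar> powr p / p + c powr p * (1 - 1/p)" for t
    using Youngs_inequality[OF p conj(2) conj(1), of "\<bar>h' t\<bar>" "c powr (p-1)"]
    unfolding powr_powr conj by simp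
  have lhs: "((\<lambda>t. \<bar>h' t\<bar> * c powr (p-1)) has_integral integral {1..2} (\<lambda>t. \<bar>h' t\<bar>) * c powr (p-1)) {1..2}"
    by (rule has_integral_mult_left[OF int_1])
  have rhs: "((\<lambda>t. \<bar>h' t\<bar> powr p / p + c powr p * (1 - 1/p)) has_integral J / p + c powr p * (1 - 1/p)) {1..2}"
    using has_integral_const_real[of "c powr p * (1 - 1/p)" 1 2]
    by (intro has_integral_add has_integral_divide int_p) simp
  have "c powr p \<le> integral {1..2} (\<lambda>t. \<bar>h' t\<bar>) * c powr (p-1)"
    using mult_right_mono[OF c_le, of "c powr (p-1)"]
    by (cases "c = 0") (auto simp: c_def powr_mult_base)
  also have "\<dots> \<le> J / p + c powr p * (1 - 1/p)"
    using has_integral_le[OF lhs rhs] young by auto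
  finally have "c powr p \<le> J"
    using p by (simp add: field_simps)
  then show ?thesis
    using nn_integral_has_integral_lebesgue'[OF _ int_p]
    by (simp add: c_def ennreal_leI)
qed

lemma powr_doubling:
  fixes s t K e :: real
  assumes "0 < s" "s \<le> t" "t \<le> K * s"
  shows "s powr e \<le> K powr \<bar>e\<bar> * t powr e"
proof -
  have K: "1 \<le> K"
    using mult_right_le_imp_le[of 1 s K] order.trans[OF assms(2,3)] assms(1) by simp
  show ?thesis
  proof (cases "0 \<le> e")
    case True
    have "s powr e \<le> t powr e"
      using assms True by (intro powr_mono2) auto
    also have "\<dots> \<le> K powr \<bar>e\<bar> * t powr e"
      using K ge_one_powr_ge_zero[of K "\<bar>e\<bar>"] by (simp add: mult_le_cancel_right1)
    finally show ?thesis .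
  next
    case False
    have "s powr e = K powr \<bar>e\<bar> * (K * s) powr e"
      using K False by (simp add: powr_mult powr_minus)
    also have "\<dots> \<le> K powr \<bar>e\<bar> * t powr e"
      using assms False by (intro mult_left_mono powr_mono2') auto
    finally show ?thesis .
  qed
qed

lemma powr_doubling':
  fixes s t K e :: real
  assumes "0 < s" "s \<le> t" "t \<le> K * s"
  shows "t powr e \<le> K powr \<bar>e\<bar> * s powr e"
  using powr_doubling[OF assms, of "-e"] assms by (simp add: powr_minus field_simps)

section \<open>Dilations and increments along them\<close>

text \<open>
  The two one-parameter groups of dilations that drive the proof are the full one,
  \<open>z \<mapsto> t z\<close>, and the partial one, \<open>(y, x) \<mapsto> (t y, x)\<close>. The boolean selects between them, so that
  the dilation argument is carried out only once. The generator of the group at \<open>z\<close> is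
  \<open>stretch_dir full z\<close>.
\<close>
definition stretch_dir :: "bool \<Rightarrow> 'a::euclidean_space \<times> 'b::euclidean_space \<Rightarrow> 'a \<times> 'b" where
  "stretch_dir full z = (fst z, if full then snd z else 0)"

definition stretch :: "bool \<Rightarrow> real \<Rightarrow> 'a::euclidean_space \<times> 'b::euclidean_space \<Rightarrow> 'a \<times> 'b" where
  "stretch full t z = z + (t - 1) *\<^sub>R stretch_dir full z"

lemma stretch_eq: "stretch full t z = (t *\<^sub>R fst z, (if full then t else 1) *\<^sub>R snd z)"
  by (simp add: stretch_def stretch_dir_def prod_eq_iff algebra_simps)

lemma stretch_1 [simp]: "stretch full 1 z = z"
  by (simp add: stretch_def)

lemma continuous_on_stretch_dir [continuous_intros]:
  "continuous_on S f \<Longrightarrow> continuous_on S (\<lambda>x. stretch_dir full (f x))"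
  unfolding stretch_dir_def by (cases full) (auto intro!: continuous_intros)

lemma continuous_on_stretch [continuous_intros]:
  "continuous_on S f \<Longrightarrow> continuous_on S g \<Longrightarrow> continuous_on S (\<lambda>x. stretch full (g x) (f x))"
  unfolding stretch_def by (auto intro!: continuous_intros)

text \<open>
  The exponent of \<open>t\<close> in the Jacobian determinant of \<open>stretch full t\<close>.
\<close>
definition stretch_dim :: "bool \<Rightarrow> ('a::euclidean_space \<times> 'b::euclidean_space) itself \<Rightarrow> nat" where
  "stretch_dim full _ = DIM('a) + (if full then DIM('b) else 0)"

lemma nn_integral_stretch:
  fixes f :: "'a::euclidean_space \<times> 'b::euclidean_space \<Rightarrow> ennreal"
  assumes [measurable]: "f \<in> borel_measurable borel" and t: "t > 0"
  shows "(\<integral>\<^sup>+z. f z \<partial>lborel) =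
    ennreal (t ^ stretch_dim full TYPE('a \<times> 'b)) * (\<integral>\<^sup>+z. f (stretch full t z) \<partial>lborel)"
proof -
  define s where "s = (if full then t else 1)"
  have s: "s > 0" using t by (simp add: s_def)
  define c :: "'a \<times> 'b \<Rightarrow> real" where "c j = (if snd j = 0 then t else s)" for j
  have T: "(\<Sum>j\<in>Basis. (c j * (z \<bullet> j)) *\<^sub>R j) = stretch full t z" for z :: "'a \<times> 'b"
  proof -
    have "(\<Sum>j\<in>Basis. (c j * (z \<bullet> j)) *\<^sub>R j)
      = (\<Sum>i\<in>Basis. (t * (fst z \<bullet> i)) *\<^sub>R (i, 0)) + (\<Sum>i\<in>Basis. (s * (snd z \<bullet> i)) *\<^sub>R (0, i))"
      by (subst sum_Basis_prod_eq) (auto simp: c_def inner_prod_def intro!: sum.cong arg_cong2[where f="(+)"])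
    also have "\<dots> = (\<Sum>i\<in>Basis. t *\<^sub>R (fst z \<bullet> i) *\<^sub>R (i, 0)) + (\<Sum>i\<in>Basis. s *\<^sub>R (snd z \<bullet> i) *\<^sub>R (0, i))"
      by simp
    also have "\<dots> = stretch full t z"
      unfolding scaleR_sum_right[symmetric]
      by (simp add: stretch_eq s_def prod_eq_iff fst_sum snd_sum euclidean_representation
        del: scaleR_scaleR)
    finally show ?thesis .
  qed
  have prod: "(\<Prod>j\<in>Basis. \<bar>c j\<bar>) = t ^ stretch_dim full TYPE('a \<times> 'b)"
  proof -
    have "(\<Prod>j\<in>Basis. \<bar>c j\<bar>) = (\<Prod>i\<in>(Basis::'a set). t) * (\<Prod>i\<in>(Basis::'b set). s)"
      unfolding Basis_prod_def using s t
      by (subst prod.union_disjoint)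
        (auto simp: prod.reindex inj_on_def c_def nonzero_Basis intro!: arg_cong2[where f="(*)"] prod.cong)
    then show ?thesis by (simp add: s_def stretch_dim_def power_add)
  qed
  have [measurable]: "stretch full t \<in> borel \<rightarrow>\<^sub>M (borel :: ('a \<times> 'b) measure)"
    by (intro borel_measurable_continuous_onI continuous_intros)
  have "(lborel :: ('a \<times> 'b) measure) = density (distr lborel borel (stretch full t)) (\<lambda>_. \<Prod>j\<in>Basis. \<bar>c j\<bar>)"
    using lborel_affine_euclidean[of c 0] s t by (simp add: T) (simp add: c_def)
  then have "(\<integral>\<^sup>+z. f z \<partial>lborel) = (\<integral>\<^sup>+z. f z \<partial>density (distr lborel borel (stretch full t)) (\<lambda>_. \<Prod>j\<in>Basis. \<bar>c j\<bar>))"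
    by simp
  also have "\<dots> = ennreal (t ^ stretch_dim full TYPE('a \<times> 'b)) * (\<integral>\<^sup>+z. f (stretch full t z) \<partial>lborel)"
    by (simp add: nn_integral_density nn_integral_distr nn_integral_cmult prod)
  finally show ?thesis .
qed

lemma stretch_increment:
  fixes u :: "'a::euclidean_space \<times> 'b::euclidean_space \<Rightarrow> real"
  assumes p: "p > 1" and du: "u differentiable_on UNIV" and cg: "continuous_on UNIV (gradient u)"
  shows "ennreal (\<bar>u z - u (stretch full 2 z)\<bar> powr p) \<le>
    (\<integral>\<^sup>+t. ennreal (norm (stretch_dir full z) powr p * norm (gradient u (stretch full t z)) powr p)
       * indicator {1..2} t \<partial>lborel)"
proof -
  let ?P = "stretch_dir full z" and ?h = "\<lambda>t. u (stretch full t z)"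
  let ?h' = "\<lambda>t. ?P \<bullet> gradient u (stretch full t z)"
  have 1: "(?h has_real_derivative ?h' t) (at t within {1..2})" for t
  proof -
    have "GDERIV u (stretch full t z) :> gradient u (stretch full t z)"
      using du by (intro gderiv_gradient) (auto simp only: differentiable_on_def)
    then have "(u has_derivative (\<lambda>h. h \<bullet> gradient u (stretch full t z))) (at (stretch full t z))"
      by (simp add: gderiv_def)
    moreover have "((\<lambda>t. stretch full t z) has_derivative (\<lambda>h. h *\<^sub>R ?P)) (at t within {1..2})"
      unfolding stretch_def by (auto intro!: derivative_eq_intros)
    ultimately have "(?h has_derivative (\<lambda>h. (h *\<^sub>R ?P) \<bullet> gradient u (stretch full t z))) (at t within {1..2})"
      using has_derivative_compose by blast
    then show ?thesis
      by (simp add: has_field_derivative_def mult.commute[of _ "?h' t"] inner_commute mult_commute_abs)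
  qed
  have 2: "continuous_on {1..2} ?h'"
    by (intro continuous_intros continuous_on_compose2[OF cg]) auto
  have "\<bar>?h' t\<bar> powr p \<le> norm ?P powr p * norm (gradient u (stretch full t z)) powr p" for t
    using p Cauchy_Schwarz_ineq2[of ?P "gradient u (stretch full t z)"]
    by (auto simp flip: powr_mult intro!: powr_mono2)
  then have "(\<integral>\<^sup>+t. ennreal (\<bar>?h' t\<bar> powr p) * indicator {1..2} t \<partial>lborel) \<le>
    (\<integral>\<^sup>+t. ennreal (norm ?P powr p * norm (gradient u (stretch full t z)) powr p) * indicator {1..2} t \<partial>lborel)"
    by (intro nn_integral_mono mult_right_mono ennreal_leI) auto
  with increment_powr_le_nn_integral[OF p 1 2] show ?thesis
    by (simp add: abs_minus_commute)
qed

text \<open>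
  Integrating the one-dimensional increment estimate against \<open>v\<close> and exchanging the order of
  integration leaves, for each \<open>t\<close>, an integral of the gradient at the dilated point. The change of
  variables back to that point produces the Jacobian \<open>t ^ n \<ge> 1\<close>, which only helps; the hypothesis
  on \<open>V\<close> is the requirement that the weight survives this transport.
\<close>
lemma stretch_increment_integral:
  fixes u :: "'a::euclidean_space \<times> 'b::euclidean_space \<Rightarrow> real" and v V :: "'a \<times> 'b \<Rightarrow> real"
  assumes p: "p > 1" and du: "u differentiable_on UNIV" and cg: "continuous_on UNIV (gradient u)"
    and [measurable]: "v \<in> borel_measurable borel" "V \<in> borel_measurable borel"
    and v: "\<And>z. 0 \<le> v z"
    and V: "\<And>z t. 1 \<le> t \<Longrightarrow> t \<le> 2 \<Longrightarrow> v z * norm (stretch_dir full z) powr p \<le> V (stretch full t z)"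
  shows "(\<integral>\<^sup>+z. ennreal (v z * \<bar>u z - u (stretch full 2 z)\<bar> powr p) \<partial>lborel) \<le>
    (\<integral>\<^sup>+z. ennreal (V z * norm (gradient u z) powr p) \<partial>lborel)"
proof -
  let ?G = "\<lambda>z. norm (gradient u z) powr p" and ?n = "stretch_dim full TYPE('a \<times> 'b)"
  let ?F = "\<lambda>z t. ennreal (v z * (norm (stretch_dir full z) powr p * ?G (stretch full t z))) * indicator {1..2} t"
  have [measurable]: "gradient u \<in> borel_measurable borel"
    using cg by (rule borel_measurable_continuous_onI)
  have [measurable]: "stretch_dir full \<in> borel \<rightarrow>\<^sub>M (borel :: ('a \<times> 'b) measure)"
    by (intro borel_measurable_continuous_onI continuous_intros)
  have "(\<lambda>(z, t). stretch full t z) \<in> borel \<rightarrow>\<^sub>M (borel :: ('a \<times> 'b) measure)"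
    unfolding case_prod_beta by (intro borel_measurable_continuous_onI continuous_intros)
  then have S[measurable]: "(\<lambda>(z, t). stretch full t z) \<in> lborel \<Otimes>\<^sub>M lborel \<rightarrow>\<^sub>M (borel :: ('a \<times> 'b) measure)"
    by (simp add: lborel_prod)
  have [measurable]: "(\<lambda>z. stretch full t z) \<in> borel \<rightarrow>\<^sub>M (borel :: ('a \<times> 'b) measure)" for t
    by (intro borel_measurable_continuous_onI continuous_intros)
  have [measurable]: "(\<lambda>(z, t). gradient u (stretch full t z)) \<in> lborel \<Otimes>\<^sub>M lborel \<rightarrow>\<^sub>M borel"
    using measurable_compose[OF S, of "gradient u" borel] by (simp add: case_prod_beta')
  have "ennreal (v z * \<bar>u z - u (stretch full 2 z)\<bar> powr p) \<le> (\<integral>\<^sup>+t. ?F z t \<partial>lborel)" for z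
  proof -
    have "ennreal (v z * \<bar>u z - u (stretch full 2 z)\<bar> powr p) =
      ennreal (v z) * ennreal (\<bar>u z - u (stretch full 2 z)\<bar> powr p)"
      using v by (simp add: ennreal_mult)
    also have "\<dots> \<le> ennreal (v z) * (\<integral>\<^sup>+t. ennreal (norm (stretch_dir full z) powr p * ?G (stretch full t z)) * indicator {1..2} t \<partial>lborel)"
      by (intro mult_left_mono stretch_increment p du cg) auto
    also have "\<dots> = (\<integral>\<^sup>+t. ennreal (v z) * (ennreal (norm (stretch_dir full z) powr p * ?G (stretch full t z)) * indicator {1..2} t) \<partial>lborel)"
      by (rule nn_integral_cmult[symmetric]) measurable
    also have "\<dots> = (\<integral>\<^sup>+t. ?F z t \<partial>lborel)"
      using v by (simp add: ennreal_mult mult.assoc)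
    finally show ?thesis .
  qed
  then have "(\<integral>\<^sup>+z. ennreal (v z * \<bar>u z - u (stretch full 2 z)\<bar> powr p) \<partial>lborel) \<le> (\<integral>\<^sup>+z. \<integral>\<^sup>+t. ?F z t \<partial>lborel \<partial>lborel)"
    by (intro nn_integral_mono)
  also have "\<dots> = (\<integral>\<^sup>+t. \<integral>\<^sup>+z. ?F z t \<partial>lborel \<partial>lborel)"
    by (rule lborel_pair.Fubini'[symmetric]) measurable
  also have "\<dots> \<le> (\<integral>\<^sup>+t. (\<integral>\<^sup>+z. ennreal (V z * ?G z) \<partial>lborel) * indicator {1..2} t \<partial>(lborel::real measure))"
  proof (rule nn_integral_mono)
    fix t :: real
    show "(\<integral>\<^sup>+z. ?F z t \<partial>lborel) \<le> (\<integral>\<^sup>+z. ennreal (V z * ?G z) \<partial>lborel) * indicator {1..2} t"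
    proof (cases "t \<in> {1..2}")
      case True
      have "(\<integral>\<^sup>+z. ?F z t \<partial>lborel) \<le> (\<integral>\<^sup>+z. ennreal (V (stretch full t z) * ?G (stretch full t z)) \<partial>lborel)"
        using True V[of t]
        by (intro nn_integral_mono) (auto simp: mult.assoc[symmetric] intro!: ennreal_leI mult_right_mono)
      also have "\<dots> \<le> ennreal (t ^ ?n) * (\<integral>\<^sup>+z. ennreal (V (stretch full t z) * ?G (stretch full t z)) \<partial>lborel)"
        using mult_right_mono[of 1 "ennreal (t ^ ?n)"] True by (simp add: one_le_power)
      also have "\<dots> = (\<integral>\<^sup>+z. ennreal (V z * ?G z) \<partial>lborel)"
        using True by (intro nn_integral_stretch[symmetric]) auto
      finally show ?thesis using True by simp
    qed simp
  qed
  also have "\<dots> = (\<integral>\<^sup>+z. ennreal (V z * ?G z) \<partial>lborel)"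
    by (subst nn_integral_cmult) auto
  finally show ?thesis .
qed

section \<open>Hardy's inequality by dilation\<close>

text \<open>
  Hardy's inequality along a dilation. Write \<open>D\<close> for the dilation by 2 and \<open>I\<close> for the left side.
  Comparing \<open>u\<close> with \<open>u \<circ> D\<close> gives \<open>I \<le> c \<integral> v \<bar>u \<circ> D\<bar>\<^sup>p + K \<integral> v \<bar>u - u \<circ> D\<bar>\<^sup>p\<close>. Changing variables in
  the first integral, the contraction hypothesis bounds it by \<open>\<theta> I\<close> plus the remainder with \<open>r\<close>;
  the second one is an increment. Since \<open>c \<theta> < 1\<close> and \<open>I\<close> is finite, \<open>c \<theta> I\<close> is absorbed on the left.
  No boundary terms or singular vector fields occur, because only values of \<open>u\<close> at two points on the
  same orbit are compared.
\<close>
lemma dilation_Hardy: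
  fixes u :: "'a::euclidean_space \<times> 'b::euclidean_space \<Rightarrow> real" and v r V :: "'a \<times> 'b \<Rightarrow> real"
  assumes p: "p > 1" and \<theta>: "0 < \<theta>" and c: "c > 0" "c * \<theta> < 1"
    and K: "K > 0" "\<And>s t. \<bar>s\<bar> powr p \<le> c * \<bar>t\<bar> powr p + K * \<bar>s - t\<bar> powr p"
    and du: "u differentiable_on UNIV" and cg: "continuous_on UNIV (gradient u)"
    and meas[measurable]: "v \<in> borel_measurable borel" "r \<in> borel_measurable borel" "V \<in> borel_measurable borel"
    and v: "\<And>z. 0 \<le> v z" and r: "\<And>z. 0 \<le> r z"
    and contr: "\<And>z. v z \<le> 2 ^ stretch_dim full TYPE('a \<times> 'b) * (\<theta> * v (stretch full 2 z) + r (stretch full 2 z))"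
    and comp: "\<And>z t. 1 \<le> t \<Longrightarrow> t \<le> 2 \<Longrightarrow> v z * norm (stretch_dir full z) powr p \<le> V (stretch full t z)"
    and fin: "(\<integral>\<^sup>+z. ennreal (v z * \<bar>u z\<bar> powr p) \<partial>lborel) < \<infinity>"
  shows "(\<integral>\<^sup>+z. ennreal (v z * \<bar>u z\<bar> powr p) \<partial>lborel) \<le>
      ennreal ((c + K) / (1 - c * \<theta>)) *
        ((\<integral>\<^sup>+z. ennreal (r z * \<bar>u z\<bar> powr p) \<partial>lborel) +
         (\<integral>\<^sup>+z. ennreal (V z * norm (gradient u z) powr p) \<partial>lborel))"
proof -
  define C where "C = (c + K) / (1 - c * \<theta>)"
  have C: "C > 0" using c K by (simp add: C_def)
  let ?n = "stretch_dim full TYPE('a \<times> 'b)" and ?D = "stretch full 2 :: 'a \<times> 'b \<Rightarrow> 'a \<times> 'b"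
  define I where "I = (\<integral>\<^sup>+z. ennreal (v z * \<bar>u z\<bar> powr p) \<partial>lborel)"
  define R where "R = (\<integral>\<^sup>+z. ennreal (r z * \<bar>u z\<bar> powr p) \<partial>lborel)"
  define E where "E = (\<integral>\<^sup>+z. ennreal (V z * norm (gradient u z) powr p) \<partial>lborel)"
  have [measurable]: "u \<in> borel_measurable borel"
    using du by (intro borel_measurable_continuous_onI differentiable_imp_continuous_on)
  have [measurable]: "?D \<in> borel \<rightarrow>\<^sub>M borel"
    by (intro borel_measurable_continuous_onI continuous_intros)
  have shifted: "(\<integral>\<^sup>+z. ennreal (v z * \<bar>u (?D z)\<bar> powr p) \<partial>lborel) \<le> ennreal \<theta> * I + R"
  proof -
    let ?f = "\<lambda>z. ennreal ((\<theta> * v z + r z) * \<bar>u z\<bar> powr p)"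
    have "(\<integral>\<^sup>+z. ennreal (v z * \<bar>u (?D z)\<bar> powr p) \<partial>lborel) \<le> (\<integral>\<^sup>+z. ennreal (2 ^ ?n) * ?f (?D z) \<partial>lborel)"
      using contr by (intro nn_integral_mono) (auto simp: mult.assoc[symmetric]
        simp flip: ennreal_mult' intro!: ennreal_leI mult_right_mono)
    also have "\<dots> = ennreal (2 ^ ?n) * (\<integral>\<^sup>+z. ?f (?D z) \<partial>lborel)"
      by (rule nn_integral_cmult) measurable
    also have "\<dots> = (\<integral>\<^sup>+z. ?f z \<partial>lborel)"
      by (rule nn_integral_stretch[symmetric]) auto
    also have "\<dots> = (\<integral>\<^sup>+z. ennreal \<theta> * ennreal (v z * \<bar>u z\<bar> powr p) + ennreal (r z * \<bar>u z\<bar> powr p) \<partial>lborel)"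
      using v r \<theta> by (intro nn_integral_cong) (simp add: distrib_right mult.assoc
          flip: ennreal_plus ennreal_mult')
    also have "\<dots> = ennreal \<theta> * I + R"
      unfolding I_def R_def by (simp add: nn_integral_add nn_integral_cmult)
    finally show ?thesis .
  qed
  have increment: "(\<integral>\<^sup>+z. ennreal (v z * \<bar>u z - u (?D z)\<bar> powr p) \<partial>lborel) \<le> E"
    unfolding E_def by (intro stretch_increment_integral p du cg meas v comp)
  have "I \<le> (\<integral>\<^sup>+z. ennreal c * ennreal (v z * \<bar>u (?D z)\<bar> powr p) +
                   ennreal K * ennreal (v z * \<bar>u z - u (?D z)\<bar> powr p) \<partial>lborel)"
    unfolding I_def
  proof (intro nn_integral_mono)
    fix z :: "'a \<times> 'b"
    have "v z * \<bar>u z\<bar> powr p \<le> v z * (c * \<bar>u (?D z)\<bar> powr p + K * \<bar>u z - u (?D z)\<bar> powr p)"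
      by (intro mult_left_mono K v)
    also have "\<dots> = c * (v z * \<bar>u (?D z)\<bar> powr p) + K * (v z * \<bar>u z - u (?D z)\<bar> powr p)"
      by (simp add: algebra_simps)
    finally show "ennreal (v z * \<bar>u z\<bar> powr p) \<le> ennreal c * ennreal (v z * \<bar>u (?D z)\<bar> powr p) +
                   ennreal K * ennreal (v z * \<bar>u z - u (?D z)\<bar> powr p)"
      using v c K by (simp flip: ennreal_mult' ennreal_plus add: ennreal_leI)
  qed
  also have "\<dots> = ennreal c * (\<integral>\<^sup>+z. ennreal (v z * \<bar>u (?D z)\<bar> powr p) \<partial>lborel) +
      ennreal K * (\<integral>\<^sup>+z. ennreal (v z * \<bar>u z - u (?D z)\<bar> powr p) \<partial>lborel)"
    by (simp add: nn_integral_add nn_integral_cmult)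
  also have "\<dots> \<le> ennreal c * (ennreal \<theta> * I + R) + ennreal K * E"
    by (intro add_mono mult_left_mono shifted increment) auto
  finally have ineq: "I \<le> ennreal c * (ennreal \<theta> * I + R) + ennreal K * E" .
  have "I \<le> ennreal C * (R + E)"
  proof (cases "R = \<infinity> \<or> E = \<infinity>")
    case True
    then show ?thesis using C by (auto simp: ennreal_mult_top)
  next
    case False
    then obtain R' E' I' where RE: "R = ennreal R'" "0 \<le> R'" "E = ennreal E'" "0 \<le> E'" "I = ennreal I'" "0 \<le> I'"
      using fin unfolding I_def[symmetric]
      by (metis ennreal_cases infinity_ennreal_def less_irrefl)
    have "I' \<le> c * (\<theta> * I' + R') + K * E'"
      using ineq RE c \<theta> K by (simp flip: ennreal_mult' ennreal_plus)
    also have "\<dots> \<le> c * \<theta> * I' + (c + K) * (R' + E')"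
      using c K RE by (simp add: algebra_simps)
    finally have "I' \<le> C * (R' + E')"
      using c by (simp add: C_def field_simps)
    then show ?thesis
      using RE C by (simp flip: ennreal_mult' ennreal_plus add: ennreal_leI)
  qed
  then show ?thesis unfolding C_def I_def R_def E_def .
qed

section \<open>The cylindrical Hardy inequality\<close>

lemma powr_le_endpoints:
  fixes x l h e :: real
  assumes "0 < l" "l \<le> x" "x \<le> h"
  shows "x powr e \<le> l powr e + h powr e"
proof (cases "0 \<le> e")
  case True
  then have "x powr e \<le> h powr e" using assms by (intro powr_mono2) auto
  then show ?thesis by (simp add: add_increasing)
next
  case False
  then have "x powr e \<le> l powr e" using assms by (intro powr_mono2') auto
  then show ?thesis by (simp add: add_increasing2)
qed

lemma nn_integral_le_const_cball:
  fixes f :: "'a::euclidean_space \<Rightarrow> real"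
  assumes "\<And>z. f z \<le> M * indicator (cball c r) z" "0 \<le> M" "0 \<le> r"
  shows "(\<integral>\<^sup>+z. ennreal (f z) \<partial>lborel) \<le> ennreal (M * (unit_ball_vol DIM('a) * r ^ DIM('a)))"
proof -
  have "(\<integral>\<^sup>+z. ennreal (f z) \<partial>lborel) \<le> (\<integral>\<^sup>+z. ennreal M * indicator (cball c r) z \<partial>lborel)"
  proof (rule nn_integral_mono)
    fix z show "ennreal (f z) \<le> ennreal M * indicator (cball c r) z"
      using assms(1)[of z] by (cases "z \<in> cball c r") (simp_all add: ennreal_leI ennreal_neg del: mem_cball)
  qed
  also have "\<dots> = ennreal (M * (unit_ball_vol DIM('a) * r ^ DIM('a)))"
    using assms by (simp add: nn_integral_cmult_indicator emeasure_cball ennreal_mult')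
  finally show ?thesis .
qed

lemma nn_integral_ge_const_cball:
  fixes f :: "'a::euclidean_space \<Rightarrow> real"
  assumes "\<And>z. z \<in> cball c r \<Longrightarrow> M \<le> f z" "0 \<le> M" "0 \<le> r"
  shows "ennreal (M * (unit_ball_vol DIM('a) * r ^ DIM('a))) \<le> (\<integral>\<^sup>+z. ennreal (f z) \<partial>lborel)"
proof -
  have "ennreal (M * (unit_ball_vol DIM('a) * r ^ DIM('a))) = (\<integral>\<^sup>+z. ennreal M * indicator (cball c r) z \<partial>lborel)"
    using assms by (simp add: nn_integral_cmult_indicator emeasure_cball ennreal_mult')
  also have "\<dots> \<le> (\<integral>\<^sup>+z. ennreal (f z) \<partial>lborel)"
    using assms(1,2) by (intro nn_integral_mono) (auto simp: ennreal_leI indicator_def)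
  finally show ?thesis .
qed

definition weight :: "real \<Rightarrow> real \<Rightarrow> 'a::euclidean_space \<times> 'b::euclidean_space \<Rightarrow> real" where
  "weight \<alpha> b z = norm (fst z) powr \<alpha> * norm z powr (- b)"

lemma weight_nonneg [simp]: "0 \<le> weight \<alpha> b z"
  by (simp add: weight_def)

lemma weight_measurable [measurable]: "weight \<alpha> b \<in> borel_measurable borel"
  unfolding weight_def
  by (intro borel_measurable_times powr_real_measurable borel_measurable_norm
    borel_measurable_const borel_measurable_continuous_onI continuous_intros)

text \<open>
  Finiteness is needed for the absorption. Away from \<open>y = 0\<close> both factors of the weight are bounded
  on the support of \<open>u\<close>.
\<close>
lemma truncated_weight_integral_finite:
  fixes u :: "'a::euclidean_space \<times> 'b::euclidean_space \<Rightarrow> real"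
  assumes cont: "continuous_on UNIV u" and supp: "compact (closure {z. u z \<noteq> 0})"
    and "p > 0" "\<delta> > 0"
    and v: "\<And>z. v z \<le> weight \<alpha> b z" "\<And>z. norm (fst z) < \<delta> \<Longrightarrow> v z = 0"
  shows "(\<integral>\<^sup>+z. ennreal (v z * \<bar>u z\<bar> powr p) \<partial>lborel) < \<infinity>"
proof -
  obtain R where "R > 0" and R: "\<And>z. u z \<noteq> 0 \<Longrightarrow> norm z \<le> R"
    using compact_imp_bounded[OF supp] closure_subset[of "{z. u z \<noteq> 0}"]
    unfolding bounded_pos by blast
  have "compact (u ` cball 0 R)"
    using cont by (intro compact_continuous_image) (auto intro: continuous_on_subset)
  then obtain M where "\<forall>x\<in>u ` cball 0 R. norm x \<le> M"
    using compact_imp_bounded[of "u ` cball 0 R"] unfolding bounded_iff by blast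
  then have M: "\<And>z. norm z \<le> R \<Longrightarrow> \<bar>u z\<bar> \<le> M"
    by (auto simp: real_norm_def)
  define K where "K = (\<delta> powr \<alpha> + R powr \<alpha>) * (\<delta> powr (-b) + R powr (-b)) * M powr p"
  have "v z * \<bar>u z\<bar> powr p \<le> K * indicator (cball 0 R) z" for z
  proof (cases "u z = 0 \<or> norm (fst z) < \<delta>")
    case True
    then have "v z * \<bar>u z\<bar> powr p = 0" using v(2)[of z] by auto
    moreover have "0 \<le> K * indicator (cball 0 R) z" by (simp add: K_def)
    ultimately show ?thesis by linarith
  next
    case False
    then have z: "\<delta> \<le> norm (fst z)" "norm z \<le> R" "norm (fst z) \<le> norm z" "\<bar>u z\<bar> \<le> M"
      using R M norm_fst_le[of "fst z" "snd z"] by auto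
    have "v z * \<bar>u z\<bar> powr p \<le> weight \<alpha> b z * \<bar>u z\<bar> powr p"
      by (intro mult_right_mono v) auto
    also have "\<dots> \<le> K"
      unfolding weight_def K_def using z \<open>\<delta> > 0\<close> \<open>p > 0\<close>
      by (intro mult_mono powr_le_endpoints powr_mono2) auto
    finally show ?thesis using z by simp
  qed
  moreover have "0 \<le> K" by (simp add: K_def)
  ultimately show ?thesis
    using nn_integral_le_const_cball[of "\<lambda>z. v z * \<bar>u z\<bar> powr p" K 0 R] \<open>R > 0\<close>
    by (simp add: le_less_trans[OF _ ennreal_less_top])
qed

lemma norm_le_fst_snd: "norm z \<le> norm (fst z) + norm (snd z)" for z :: "'a::real_normed_vector \<times> 'b::real_normed_vector"
  using norm_Pair_le[of "fst z" "snd z"] by simp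

lemma norm_fst_le_norm: "norm (fst z) \<le> norm z" and norm_snd_le_norm: "norm (snd z) \<le> norm z"
  for z :: "'a::real_normed_vector \<times> 'b::real_normed_vector"
  using norm_fst_le[of "fst z" "snd z"] norm_snd_le[of "snd z" "fst z"] by simp_all

lemma stretch_norm_bounds:
  fixes z :: "'a::euclidean_space \<times> 'b::euclidean_space"
  assumes "1 \<le> t"
  shows "norm (fst (stretch full t z)) = t * norm (fst z)"
    "norm z \<le> norm (stretch full t z)" "norm (stretch full t z) \<le> t * norm z"
proof -
  show "norm (fst (stretch full t z)) = t * norm (fst z)"
    using assms by (simp add: stretch_eq)
  have 1: "norm (fst z) \<le> norm (t *\<^sub>R fst z)" "norm (snd z) \<le> norm ((if full then t else 1) *\<^sub>R snd z)"
    using assms by (auto simp: mult_le_cancel_right1)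
  show "norm z \<le> norm (stretch full t z)"
    unfolding stretch_eq norm_Pair norm_prod_def[of z] using 1
    by (intro real_sqrt_le_mono add_mono power_mono) auto
  have 2: "norm ((if full then t else 1) *\<^sub>R snd z) \<le> norm (t *\<^sub>R snd z)"
    using assms by (auto simp: mult_le_cancel_right1)
  have "norm (stretch full t z) \<le> norm (t *\<^sub>R z)"
    unfolding stretch_eq norm_Pair norm_prod_def[of "t *\<^sub>R z"] fst_scaleR snd_scaleR using 2
    by (intro real_sqrt_le_mono add_mono power_mono) auto
  then show "norm (stretch full t z) \<le> t * norm z" using assms by simp
qed

text \<open>
  The factor \<open>\<bar>y\<bar>\<close> scales exactly under either dilation, but \<open>\<bar>z\<bar>\<close> does so only for the full one.
  The loss in the second factor is controlled by the ratio \<open>L\<close>, which is close to 1 for a partial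
  dilation in a thin cone around \<open>y = 0\<close>.
\<close>
lemma weight_le_weight_stretch:
  fixes z :: "'a::euclidean_space \<times> 'b::euclidean_space"
  assumes t: "1 \<le> t" and z: "fst z \<noteq> 0" and L: "norm (stretch full t z) \<le> L * norm z"
  shows "weight \<alpha> b z \<le> t powr (- \<alpha>) * L powr \<bar>b\<bar> * weight \<alpha> b (stretch full t z)"
proof -
  note s = stretch_norm_bounds[OF t]
  have zpos: "0 < norm z" using z by (auto simp: prod_eq_iff)
  have "weight \<alpha> b z = t powr (- \<alpha>) * norm (fst (stretch full t z)) powr \<alpha> * norm z powr (- b)"
    unfolding weight_def using t by (simp add: s powr_mult powr_minus)
  also have "\<dots> \<le> t powr (- \<alpha>) * norm (fst (stretch full t z)) powr \<alpha> * (L powr \<bar>b\<bar> * norm (stretch full t z) powr (- b))"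
    using powr_doubling[OF zpos s(2) L, of "-b"] by (intro mult_left_mono) auto
  finally show ?thesis by (simp add: weight_def mult_ac)
qed

lemma weight_scaleR:
  assumes "t > 0"
  shows "weight \<alpha> b (t *\<^sub>R z) = t powr (\<alpha> - b) * weight \<alpha> b z"
  using assms by (simp add: weight_def powr_mult powr_diff powr_minus field_simps)

text \<open>
  The space is split into the cone \<open>\<bar>y\<bar> \<ge> \<epsilon> \<bar>x\<bar>\<close> and its complement. On the cone, \<open>\<bar>y\<bar>\<close> and \<open>\<bar>z\<bar>\<close> are
  comparable and the full dilation contracts, because the weight is homogeneous of degree \<open>\<alpha> - b\<close> and
  \<open>d + \<alpha> - b > 0\<close>. Near \<open>y = 0\<close> the factor \<open>\<bar>z\<bar> powr (- b)\<close> is almost invariant under the partial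
  dilation, which contracts because \<open>k + \<alpha> > 0\<close>; it moves part of the mass into the cone, and this
  part is a remainder that has been estimated already. Truncating the weight to \<open>\<bar>y\<bar> \<ge> \<delta>\<close> makes all
  integrals finite and is compatible with both dilations, since they increase \<open>\<bar>y\<bar>\<close>; the
  constant does not depend on \<open>\<delta>\<close>.
\<close>
theorem weighted_Hardy:
  fixes p \<alpha> b :: real
  assumes p: "p > 1" and \<alpha>: "DIM('a) + \<alpha> > 0" and \<alpha>b: "DIM('a) + DIM('b) + \<alpha> - b > 0"
  shows "\<exists>C>0. \<forall>u :: 'a::euclidean_space \<times> 'b::euclidean_space \<Rightarrow> real.
      u differentiable_on UNIV \<longrightarrow> continuous_on UNIV (gradient u) \<longrightarrow> compact (closure {z. u z \<noteq> 0}) \<longrightarrow>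
      (\<integral>\<^sup>+z. ennreal (weight \<alpha> b z * \<bar>u z\<bar> powr p) \<partial>lborel) \<le>
      ennreal C * (\<integral>\<^sup>+z. ennreal (weight \<alpha> b z * norm (fst z) powr p * norm (gradient u z) powr p) \<partial>lborel)"
proof -
  let ?k = "real DIM('a)" and ?m = "real DIM('b)"
  \<comment> \<open>The largest distortion of \<open>\<bar>z\<bar>\<close> that is tolerated near \<open>y = 0\<close>: by the next estimate it costs
    half of the exponent in the gain \<open>2 powr (- (k + \<alpha>))\<close> of the partial dilation.\<close>
  define H where "H = 2 powr ((?k + \<alpha>) / (2 * (\<bar>b\<bar> + 1)))"
  have H: "H > 1"
    unfolding H_def using \<alpha> powr_less_mono[of 0 "(?k + \<alpha>) / (2 * (\<bar>b\<bar> + 1))" 2] by auto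
  define \<epsilon> where "\<epsilon> = (H - 1) / 2"
  have \<epsilon>: "\<epsilon> > 0" "1 + 2 * \<epsilon> = H" using H by (auto simp: \<epsilon>_def field_simps)
  have Hb: "H powr \<bar>b\<bar> \<le> 2 powr ((?k + \<alpha>) / 2)"
  proof -
    have "H powr \<bar>b\<bar> \<le> H powr (\<bar>b\<bar> + 1)" using H by (intro powr_mono) auto
    also have "\<dots> = 2 powr ((?k + \<alpha>) / 2)"
    proof -
      have "\<bar>b\<bar> + 1 \<noteq> 0" by linarith
      from nonzero_mult_divide_mult_cancel_right[OF this, of "?k + \<alpha>" 2]
      show ?thesis by (simp only: H_def powr_powr times_divide_eq_left)
    qed
    finally show ?thesis .
  qed
  define \<theta> where "\<theta> = max (2 powr (- (?k + ?m + \<alpha> - b))) (2 powr (- ((?k + \<alpha>) / 2)))"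
  have \<theta>: "0 < \<theta>" "\<theta> < 1" "2 powr (- (?k + ?m + \<alpha> - b)) \<le> \<theta>" "2 powr (- ((?k + \<alpha>) / 2)) \<le> \<theta>"
    using \<alpha> \<alpha>b powr_less_mono[of "- (?k + ?m + \<alpha> - b)" 0 2] powr_less_mono[of "- ((?k + \<alpha>) / 2)" 0 2]
    by (auto simp: \<theta>_def less_max_iff_disj)
  \<comment> \<open>Any \<open>c\<close> strictly between 1 and \<open>1 / \<theta>\<close> allows the absorption.\<close>
  define c where "c = (1 + 1 / \<theta>) / 2"
  have c: "c > 1" "c * \<theta> < 1"
    using \<theta> by (auto simp: c_def field_simps)
  obtain K where K: "K > 0" "\<And>s t. \<bar>s\<bar> powr p \<le> c * \<bar>t\<bar> powr p + K * \<bar>s - t\<bar> powr p"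
    using powr_le_combination[of p c] p c by auto
  define C where "C = (c + K) / (1 - c * \<theta>)"
  have C: "C > 0" using c K by (simp add: C_def)
  define A where "A = 2 powr \<bar>\<alpha>\<bar> * 2 powr \<bar>b\<bar>"
  define B where "B = A * (1 + 1 / \<epsilon>) powr p"
  have A: "A > 0" by (simp add: A_def)
  have "1 + 1 / \<epsilon> > 0" using \<epsilon> by (simp add: add_pos_pos)
  with A have B: "B > 0" by (simp add: B_def)
  have AB: "A \<le> B"
    using A \<epsilon> p ge_one_powr_ge_zero[of "1 + 1 / \<epsilon>" p] by (simp add: B_def mult_le_cancel_left1)
  define V where "V z = B * (weight \<alpha> b z * norm (fst z) powr p)" for z :: "'a \<times> 'b"
  have [measurable]: "(fst :: 'a \<times> 'b \<Rightarrow> 'a) \<in> borel_measurable borel" "(snd :: 'a \<times> 'b \<Rightarrow> 'b) \<in> borel_measurable borel"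
    by (auto intro!: borel_measurable_continuous_onI continuous_intros)
  have [measurable]: "V \<in> borel_measurable borel"
    unfolding V_def by measurable
  have comparable: "weight \<alpha> b z \<le> A * weight \<alpha> b (stretch full t z)"
    if "1 \<le> t" "t \<le> 2" "fst z \<noteq> 0" for full t and z :: "'a \<times> 'b"
  proof -
    have "norm (stretch full t z) \<le> 2 * norm z"
      using that by (intro order.trans[OF stretch_norm_bounds(3)] mult_right_mono) auto
    then have "weight \<alpha> b z \<le> t powr (- \<alpha>) * 2 powr \<bar>b\<bar> * weight \<alpha> b (stretch full t z)"
      using that by (intro weight_le_weight_stretch)
    also have "\<dots> \<le> A * weight \<alpha> b (stretch full t z)"
    proof -
      have "t powr (- \<alpha>) \<le> t powr \<bar>\<alpha>\<bar>" using that by (intro powr_mono) auto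
      also have "\<dots> \<le> 2 powr \<bar>\<alpha>\<bar>" using that by (intro powr_mono2) auto
      finally show ?thesis unfolding A_def by (intro mult_right_mono) auto
    qed
    finally show ?thesis .
  qed
  show ?thesis
  proof (intro exI[of _ "C * B * (2 + C)"] conjI allI impI)
    show "C * B * (2 + C) > 0" using C B by simp
    fix u :: "'a \<times> 'b \<Rightarrow> real"
    assume du: "u differentiable_on UNIV" and cg: "continuous_on UNIV (gradient u)"
      and supp: "compact (closure {z. u z \<noteq> 0})"
    have cu: "continuous_on UNIV u" using du by (rule differentiable_imp_continuous_on)
    have [measurable]: "u \<in> borel_measurable borel" "gradient u \<in> borel_measurable borel"
      using cu cg by (auto intro: borel_measurable_continuous_onI)
    define T where "T = (\<integral>\<^sup>+z. ennreal (weight \<alpha> b z * norm (fst z) powr p * norm (gradient u z) powr p) \<partial>lborel)"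
    have VT: "(\<integral>\<^sup>+z. ennreal (V z * norm (gradient u z) powr p) \<partial>lborel) = ennreal B * T"
      using B unfolding V_def T_def
      by (subst nn_integral_cmult[symmetric]) (auto simp: mult.assoc ennreal_mult intro!: nn_integral_cong)
    have truncated: "(\<integral>\<^sup>+z. ennreal ((if \<delta> \<le> norm (fst z) then weight \<alpha> b z else 0) * \<bar>u z\<bar> powr p) \<partial>lborel)
        \<le> ennreal (C * B * (2 + C)) * T" if \<delta>: "\<delta> > 0" for \<delta>
    proof -
      define v1 where "v1 z = (if \<delta> \<le> norm (fst z) \<and> \<epsilon> * norm (snd z) \<le> norm (fst z) then weight \<alpha> b z else 0)"
        for z :: "'a \<times> 'b"
      define v2 where "v2 z = (if \<delta> \<le> norm (fst z) \<and> norm (fst z) < \<epsilon> * norm (snd z) then weight \<alpha> b z else 0)"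
        for z :: "'a \<times> 'b"
      have [measurable]: "v1 \<in> borel_measurable borel" "v2 \<in> borel_measurable borel"
        unfolding v1_def v2_def by measurable
      have nonneg: "0 \<le> v1 z" "0 \<le> v2 z" for z
        by (auto simp: v1_def v2_def)
      have fin: "(\<integral>\<^sup>+z. ennreal (v1 z * \<bar>u z\<bar> powr p) \<partial>lborel) < \<infinity>"
         "(\<integral>\<^sup>+z. ennreal (v2 z * \<bar>u z\<bar> powr p) \<partial>lborel) < \<infinity>"
        using p by (auto intro!: truncated_weight_integral_finite[OF cu supp _ \<delta>, where \<alpha> = \<alpha> and b = b]
          simp del: infinity_ennreal_def simp: v1_def v2_def)
      define I1 where "I1 = (\<integral>\<^sup>+z. ennreal (v1 z * \<bar>u z\<bar> powr p) \<partial>lborel)"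
      define I2 where "I2 = (\<integral>\<^sup>+z. ennreal (v2 z * \<bar>u z\<bar> powr p) \<partial>lborel)"
      have "I1 \<le> ennreal C * ((\<integral>\<^sup>+z. ennreal (0 * \<bar>u z\<bar> powr p) \<partial>lborel) +
        (\<integral>\<^sup>+z. ennreal (V z * norm (gradient u z) powr p) \<partial>lborel))"
        unfolding I1_def C_def
      proof (rule dilation_Hardy[where full = True and r = "\<lambda>_. 0" and v = v1, OF p \<theta>(1) _ c(2) K du cg])
        fix z :: "'a \<times> 'b"
        show "v1 z \<le> 2 ^ stretch_dim True TYPE('a \<times> 'b) * (\<theta> * v1 (stretch True 2 z) + 0)"
        proof (cases "v1 z = 0")
          case False
          then have z: "\<delta> \<le> norm (fst z)" "\<epsilon> * norm (snd z) \<le> norm (fst z)"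
            by (auto simp: v1_def split: if_splits)
          have s: "stretch True 2 z = 2 *\<^sub>R z" by (simp add: stretch_eq prod_eq_iff)
          have v1s: "v1 (2 *\<^sub>R z) = weight \<alpha> b (2 *\<^sub>R z)" using z \<delta> by (auto simp: v1_def)
          have "v1 z = 2 powr (b - \<alpha>) * weight \<alpha> b (2 *\<^sub>R z)"
            using z by (simp add: v1_def weight_scaleR mult.assoc[symmetric] flip: powr_add)
          also have "2 powr (b - \<alpha>) = 2 ^ stretch_dim True TYPE('a \<times> 'b) * 2 powr (- (?k + ?m + \<alpha> - b))"
            by (simp add: stretch_dim_def flip: powr_realpow powr_add)
          also have "\<dots> * weight \<alpha> b (2 *\<^sub>R z) \<le> (2 ^ stretch_dim True TYPE('a \<times> 'b) * \<theta>) * weight \<alpha> b (2 *\<^sub>R z)"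
            by (intro mult_right_mono mult_left_mono \<theta>) auto
          finally show ?thesis by (simp add: s v1s)
        qed (use \<theta> nonneg in auto)
      next
        fix z :: "'a \<times> 'b" and t :: real
        assume t: "1 \<le> t" "t \<le> 2"
        show "v1 z * norm (stretch_dir True z) powr p \<le> V (stretch True t z)"
        proof (cases "v1 z = 0")
          case False
          then have z: "\<delta> \<le> norm (fst z)" "\<epsilon> * norm (snd z) \<le> norm (fst z)"
            by (auto simp: v1_def split: if_splits)
          have y0: "fst z \<noteq> 0" using z(1) \<delta> by auto
          have "norm (stretch_dir True z) \<le> norm (fst z) + norm (snd z)"
            using norm_le_fst_snd[of z] by (simp add: stretch_dir_def)
          also have "\<dots> \<le> (1 + 1 / \<epsilon>) * norm (fst z)"
            using z \<epsilon>(1) by (simp add: field_simps)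
          also have "\<dots> \<le> (1 + 1 / \<epsilon>) * norm (fst (stretch True t z))"
            using \<epsilon> t by (intro mult_left_mono) (auto simp: stretch_norm_bounds mult_le_cancel_right1)
          finally have "norm (stretch_dir True z) powr p \<le> ((1 + 1 / \<epsilon>) * norm (fst (stretch True t z))) powr p"
            using p by (intro powr_mono2) auto
          moreover have "v1 z \<le> A * weight \<alpha> b (stretch True t z)"
            using comparable[OF t y0, of True] z by (auto simp: v1_def)
          ultimately have "v1 z * norm (stretch_dir True z) powr p \<le>
            (A * weight \<alpha> b (stretch True t z)) * ((1 + 1 / \<epsilon>) * norm (fst (stretch True t z))) powr p"
            using A by (intro mult_mono) auto
          then show ?thesis by (simp add: V_def B_def powr_mult mult_ac)
        qed (use B in \<open>auto simp: V_def\<close>)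
      qed (use fin nonneg c in auto)
      then have I1: "I1 \<le> ennreal C * (ennreal B * T)" by (simp add: VT)
      have "I2 \<le> ennreal C * ((\<integral>\<^sup>+z. ennreal (v1 z * \<bar>u z\<bar> powr p) \<partial>lborel) +
        (\<integral>\<^sup>+z. ennreal (V z * norm (gradient u z) powr p) \<partial>lborel))"
        unfolding I2_def C_def
      proof (rule dilation_Hardy[where full = False and r = v1 and v = v2, OF p \<theta>(1) _ c(2) K du cg])
        fix z :: "'a \<times> 'b"
        show "v2 z \<le> 2 ^ stretch_dim False TYPE('a \<times> 'b) * (\<theta> * v2 (stretch False 2 z) + v1 (stretch False 2 z))"
        proof (cases "v2 z = 0")
          case False
          then have z: "\<delta> \<le> norm (fst z)" "norm (fst z) < \<epsilon> * norm (snd z)"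
            by (auto simp: v2_def split: if_splits)
          have y0: "fst z \<noteq> 0" using z(1) \<delta> by auto
          let ?z = "stretch False 2 z"
          have "norm ?z \<le> 2 * norm (fst z) + norm (snd z)"
            using norm_le_fst_snd[of ?z] by (simp add: stretch_eq)
          also have "\<dots> \<le> H * norm (snd z)"
            using z unfolding \<epsilon>(2)[symmetric] by (simp add: algebra_simps)
          also have "\<dots> \<le> H * norm z"
            using H by (intro mult_left_mono norm_snd_le_norm) auto
          finally have "weight \<alpha> b z \<le> 2 powr (- \<alpha>) * H powr \<bar>b\<bar> * weight \<alpha> b ?z"
            using y0 by (intro weight_le_weight_stretch) auto
          also have "\<dots> \<le> 2 powr (- \<alpha>) * 2 powr ((?k + \<alpha>) / 2) * weight \<alpha> b ?z"
            by (intro mult_right_mono mult_left_mono Hb) auto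
          also have "2 powr (- \<alpha>) * 2 powr ((?k + \<alpha>) / 2) =
              2 ^ stretch_dim False TYPE('a \<times> 'b) * 2 powr (- ((?k + \<alpha>) / 2))"
            by (simp add: stretch_dim_def field_simps flip: powr_realpow powr_add)
          also have "\<dots> * weight \<alpha> b ?z \<le> 2 ^ stretch_dim False TYPE('a \<times> 'b) * \<theta> * weight \<alpha> b ?z"
            by (intro mult_right_mono mult_left_mono \<theta>) auto
          also have "weight \<alpha> b ?z = v2 ?z + v1 ?z"
            using z \<delta> by (auto simp: v1_def v2_def stretch_norm_bounds)
          also have "2 ^ stretch_dim False TYPE('a \<times> 'b) * \<theta> * (v2 ?z + v1 ?z)
            \<le> 2 ^ stretch_dim False TYPE('a \<times> 'b) * (\<theta> * v2 ?z + v1 ?z)"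
            using \<theta> nonneg[of ?z] by (simp add: distrib_left mult.assoc mult_left_le_one_le)
          finally show ?thesis using z by (simp add: v2_def)
        qed (use \<theta> nonneg in auto)
      next
        fix z :: "'a \<times> 'b" and t :: real
        assume t: "1 \<le> t" "t \<le> 2"
        show "v2 z * norm (stretch_dir False z) powr p \<le> V (stretch False t z)"
        proof (cases "v2 z = 0")
          case False
          then have z: "\<delta> \<le> norm (fst z)" by (auto simp: v2_def split: if_splits)
          have y0: "fst z \<noteq> 0" using z \<delta> by auto
          have "norm (stretch_dir False z) powr p \<le> norm (fst (stretch False t z)) powr p"
            using p t by (intro powr_mono2) (auto simp: stretch_norm_bounds mult_le_cancel_right1 stretch_dir_def)
          moreover have "v2 z \<le> B * weight \<alpha> b (stretch False t z)"
            using comparable[OF t y0, of False] z B mult_right_mono[OF AB, of "weight \<alpha> b (stretch False t z)"]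
            by (auto simp: v2_def)
          ultimately have "v2 z * norm (stretch_dir False z) powr p \<le>
            (B * weight \<alpha> b (stretch False t z)) * norm (fst (stretch False t z)) powr p"
            using B by (intro mult_mono) auto
          then show ?thesis by (simp add: V_def mult_ac)
        qed (use B in \<open>auto simp: V_def\<close>)
      qed (use fin nonneg c in auto)
      then have "I2 \<le> ennreal C * (I1 + ennreal B * T)" by (simp add: VT I1_def)
      also have "\<dots> \<le> ennreal C * (ennreal C * (ennreal B * T) + ennreal B * T)"
        by (intro mult_left_mono add_right_mono I1) auto
      finally have I2: "I2 \<le> ennreal C * (ennreal C * (ennreal B * T) + ennreal B * T)" .
      have "(\<integral>\<^sup>+z. ennreal ((if \<delta> \<le> norm (fst z) then weight \<alpha> b z else 0) * \<bar>u z\<bar> powr p) \<partial>lborel)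
        = (\<integral>\<^sup>+z. ennreal (v1 z * \<bar>u z\<bar> powr p) + ennreal (v2 z * \<bar>u z\<bar> powr p) \<partial>lborel)"
        by (intro nn_integral_cong) (auto simp: v1_def v2_def)
      also have "\<dots> = I1 + I2"
        unfolding I1_def I2_def by (rule nn_integral_add) auto
      also have "\<dots> \<le> ennreal C * (ennreal B * T) + ennreal C * (ennreal C * (ennreal B * T) + ennreal B * T)"
        by (intro add_mono I1 I2)
      also have "\<dots> = (ennreal C * ennreal B * (1 + 1 + ennreal C)) * T"
        by (simp add: distrib_left distrib_right mult_ac add_ac del: one_add_one)
      also have "\<dots> = ennreal (C * B * (2 + C)) * T"
        using C B by (simp add: ennreal_mult)
      finally show ?thesis .
    qed
    define f where "f n z = ennreal ((if 1 / real (Suc n) \<le> norm (fst z) then weight \<alpha> b z else 0) * \<bar>u z\<bar> powr p)"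
      for n and z :: "'a \<times> 'b"
    have [measurable]: "f n \<in> borel_measurable borel" for n
      unfolding f_def by measurable
    have inc: "incseq f"
    proof (rule incseq_SucI, rule le_funI)
      fix n and z :: "'a \<times> 'b"
      have "1 / real (Suc (Suc n)) \<le> 1 / real (Suc n)" by (intro divide_left_mono) auto
      then show "f n z \<le> f (Suc n) z" unfolding f_def by (intro ennreal_leI mult_right_mono) auto
    qed
    have "(\<integral>\<^sup>+z. ennreal (weight \<alpha> b z * \<bar>u z\<bar> powr p) \<partial>lborel) \<le> (\<integral>\<^sup>+z. (SUP n. f n z) \<partial>lborel)"
    proof (rule nn_integral_mono)
      fix z :: "'a \<times> 'b"
      show "ennreal (weight \<alpha> b z * \<bar>u z\<bar> powr p) \<le> (SUP n. f n z)"
      proof (cases "fst z = 0")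
        case False
        then obtain n where "inverse (real (Suc n)) < norm (fst z)"
          using reals_Archimedean[of "norm (fst z)"] by auto
        then show ?thesis by (intro SUP_upper2[of n]) (auto simp: f_def inverse_eq_divide)
      qed (simp add: weight_def)
    qed
    also have "\<dots> = (SUP n. \<integral>\<^sup>+z. f n z \<partial>lborel)"
      by (rule nn_integral_monotone_convergence_SUP[OF inc]) auto
    also have "\<dots> \<le> ennreal (C * B * (2 + C)) * T"
      unfolding f_def by (intro SUP_least truncated) auto
    finally show "(\<integral>\<^sup>+z. ennreal (weight \<alpha> b z * \<bar>u z\<bar> powr p) \<partial>lborel) \<le> ennreal (C * B * (2 + C)) *
      (\<integral>\<^sup>+z. ennreal (weight \<alpha> b z * norm (fst z) powr p * norm (gradient u z) powr p) \<partial>lborel)"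
      by (simp only: T_def)
  qed
qed

section \<open>Smooth bump functions\<close>

text \<open>
  The derivative of \<open>flat m\<close> is a combination of \<open>flat (m + 2)\<close> and \<open>flat (m + 1)\<close>, so the family
  obtained from \<open>exp (- 1 / t)\<close> by dividing by powers is closed under differentiation.
\<close>
definition flat :: "nat \<Rightarrow> real \<Rightarrow> real" where
  "flat m t = (if t > 0 then exp (- 1 / t) / t ^ m else 0)"

lemma flat_nonneg: "0 \<le> flat m t"
  by (simp add: flat_def)

lemma flat_tendsto_0: "(flat m \<longlongrightarrow> 0) (at 0)"
proof -
  have "((\<lambda>t. (inverse t) ^ m / exp (inverse t)) \<longlongrightarrow> 0) (at_right (0::real))"
    by (rule filterlim_compose[OF tendsto_power_div_exp_0 filterlim_inverse_at_top_right])
  then have "(flat m \<longlongrightarrow> 0) (at_right 0)"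
    by (rule Lim_transform_eventually)
       (auto simp: flat_def eventually_at_filter exp_minus field_simps intro!: always_eventually)
  moreover have "(flat m \<longlongrightarrow> 0) (at_left 0)"
    by (rule Lim_transform_eventually[OF tendsto_const])
       (auto simp: flat_def eventually_at_filter intro!: always_eventually)
  ultimately show ?thesis by (simp add: filterlim_at_split)
qed

lemma flat_has_derivative:
  "(flat m has_real_derivative flat (m + 2) t - real m * flat (m + 1) t) (at t)"
proof (cases t "0 :: real" rule: linorder_cases)
  case less
  have "((\<lambda>_. 0) has_real_derivative 0) (at t)" by simp
  moreover have "\<forall>\<^sub>F x in nhds t. x < 0"
    using less by (intro eventually_nhds_in_open[of "{..<0}", simplified]) auto
  then have "\<forall>\<^sub>F x in nhds t. 0 = flat m x" by eventually_elim (auto simp: flat_def)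
  ultimately have "(flat m has_real_derivative 0) (at t)"
    using DERIV_cong_ev[of t t "\<lambda>_. 0" "flat m" 0 0] by simp
  then show ?thesis using less by (simp add: flat_def)
next
  case equal
  \<comment> \<open>The difference quotient of \<open>flat m\<close> at 0 is \<open>flat (m + 1)\<close>.\<close>
  have "((\<lambda>h. (flat m (0 + h) - flat m 0) / h) \<longlongrightarrow> 0) (at 0)"
    by (rule Lim_transform_eventually[OF flat_tendsto_0[of "Suc m"]])
       (auto simp: flat_def eventually_at_filter intro!: always_eventually)
  then show ?thesis using equal by (simp add: DERIV_def flat_def)
next
  case greater
  let ?g = "\<lambda>t. exp (- 1 / t) / t ^ m"
  have m: "real m * t ^ (m - Suc 0) * t = real m * t ^ m"
    by (cases m) auto
  have "(?g has_real_derivative exp (- 1 / t) / t ^ (m + 2) - real m * (exp (- 1 / t) / t ^ (m + 1))) (at t)"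
    using greater m
    by (auto intro!: derivative_eq_intros simp: field_simps power2_eq_square)
  moreover have "\<forall>\<^sub>F x in nhds t. x > 0"
    using greater by (intro eventually_nhds_in_open[of "{0<..}", simplified]) auto
  then have "\<forall>\<^sub>F x in nhds t. ?g x = flat m x" by eventually_elim (auto simp: flat_def)
  ultimately have "(flat m has_real_derivative exp (- 1 / t) / t ^ (m + 2) - real m * (exp (- 1 / t) / t ^ (m + 1))) (at t)"
    using DERIV_cong_ev[of t t ?g "flat m"] by blast
  then show ?thesis using greater by (simp add: flat_def)
qed

lemma flat_2_le: "flat 2 t \<le> 2"
proof (cases "t > 0")
  case True
  define s where "s = 1 / t"
  have "s > 0" using True by (simp add: s_def)
  have "s ^ 2 / 2 \<le> exp s"
    using exp_lower_Taylor_quadratic[of s] \<open>s > 0\<close> by simp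
  then have "s ^ 2 * exp (- s) \<le> 2" by (simp add: exp_minus field_simps)
  then show ?thesis using True by (simp add: flat_def s_def power_divide field_simps)
qed (simp add: flat_def)

definition bump_profile :: "'a::euclidean_space \<Rightarrow> real \<Rightarrow> 'a \<Rightarrow> real" where
  "bump_profile c r z = 1 - (z - c) \<bullet> (z - c) / r\<^sup>2"

text \<open>
  An algebra of functions that contains the bump function and is closed under all directional
  derivatives; smoothness of every member then follows by induction on the order.
\<close>
inductive bump_algebra :: "'a::euclidean_space \<Rightarrow> real \<Rightarrow> ('a \<Rightarrow> real) \<Rightarrow> bool" for c r where
  const: "bump_algebra c r (\<lambda>_. k)"
| linear: "bump_algebra c r (\<lambda>z. z \<bullet> v)"
| flat: "bump_algebra c r (\<lambda>z. flat m (bump_profile c r z))"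
| add: "bump_algebra c r f \<Longrightarrow> bump_algebra c r g \<Longrightarrow> bump_algebra c r (\<lambda>z. f z + g z)"
| mult: "bump_algebra c r f \<Longrightarrow> bump_algebra c r g \<Longrightarrow> bump_algebra c r (\<lambda>z. f z * g z)"

lemma flat_profile_has_derivative:
  "((\<lambda>z. flat m (bump_profile c r z)) has_derivative
    (\<lambda>h. (flat (m + 2) (bump_profile c r z) - real m * flat (m + 1) (bump_profile c r z)) *
      (- 2 / r\<^sup>2 * (h \<bullet> (z - c))))) (at z)"
proof -
  have "(bump_profile c r has_derivative (\<lambda>h. - 2 / r\<^sup>2 * (h \<bullet> (z - c)))) (at z)"
    unfolding bump_profile_def divide_inverse
    by (auto intro!: derivative_eq_intros ext simp: inner_commute algebra_simps)
  from has_derivative_compose[OF this flat_has_derivative[of m "bump_profile c r z", unfolded has_field_derivative_def]]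
  show ?thesis by simp
qed

lemma bump_algebra_derivative:
  assumes "bump_algebra c r g"
  shows "\<exists>g'. (\<forall>z. (g has_derivative g' z) (at z)) \<and> (\<forall>v. bump_algebra c r (\<lambda>z. g' z v))"
  using assms
proof induction
  case (const k)
  show ?case
    by (rule exI[of _ "\<lambda>_ _. 0"]) (auto intro: bump_algebra.const)
next
  case (linear v)
  show ?case
    by (rule exI[of _ "\<lambda>_ h. h \<bullet> v"]) (auto intro: bump_algebra.const intro!: derivative_eq_intros)
next
  case (flat m)
  let ?d = "\<lambda>z h. (flat (m + 2) (bump_profile c r z) + (- real m) * flat (m + 1) (bump_profile c r z)) *
      (- 2 / r\<^sup>2 * (z \<bullet> h + (- (c \<bullet> h))))"
  have "((\<lambda>z. flat m (bump_profile c r z)) has_derivative ?d z) (at z)" for z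
    using flat_profile_has_derivative[of m c r z] by (simp add: inner_diff_right inner_commute)
  moreover have "bump_algebra c r (\<lambda>z. ?d z h)" for h
    by (intro bump_algebra.intros)
  ultimately show ?case by (intro exI[of _ ?d] conjI allI)
next
  case (add f g)
  then obtain f' g' where
    "\<And>z. (f has_derivative f' z) (at z)" "\<And>v. bump_algebra c r (\<lambda>z. f' z v)"
    "\<And>z. (g has_derivative g' z) (at z)" "\<And>v. bump_algebra c r (\<lambda>z. g' z v)" by blast
  then show ?case
    by (intro exI[of _ "\<lambda>z h. f' z h + g' z h"]) (auto intro: has_derivative_add bump_algebra.add)
next
  case (mult f g)
  then obtain f' g' where
    "\<And>z. (f has_derivative f' z) (at z)" "\<And>v. bump_algebra c r (\<lambda>z. f' z v)"
    "\<And>z. (g has_derivative g' z) (at z)" "\<And>v. bump_algebra c r (\<lambda>z. g' z v)" by blast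
  then show ?case using mult.hyps
    by (intro exI[of _ "\<lambda>z h. f z * g' z h + f' z h * g z"] conjI allI has_derivative_mult
      bump_algebra.add bump_algebra.mult)
qed

lemma bump_algebra_smooth: "bump_algebra c r g \<Longrightarrow> continuously_differentiable n g"
proof (induction n arbitrary: g)
  case 0
  then obtain g' where "\<And>z. (g has_derivative g' z) (at z)" using bump_algebra_derivative by blast
  then have "g differentiable_on UNIV"
    by (auto simp: differentiable_on_def differentiable_def)
  then show ?case by (simp add: differentiable_imp_continuous_on)
next
  case (Suc n)
  then obtain g' where g': "\<And>z. (g has_derivative g' z) (at z)" "\<And>v. bump_algebra c r (\<lambda>z. g' z v)"
    using bump_algebra_derivative by blast
  have "frechet_derivative g (at z) = g' z" for z
    using frechet_derivative_at[OF g'(1)] by simp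
  moreover have "g differentiable_on UNIV"
    using g'(1) by (auto simp: differentiable_on_def differentiable_def)
  ultimately show ?case using Suc.IH g'(2) by simp
qed

definition bump :: "'a::euclidean_space \<Rightarrow> real \<Rightarrow> 'a \<Rightarrow> real" where
  "bump c r z = flat 0 (bump_profile c r z)"

lemma bump_eq_0:
  assumes "r > 0" "norm (z - c) \<ge> r"
  shows "flat m (bump_profile c r z) = 0"
proof -
  have "r\<^sup>2 \<le> (z - c) \<bullet> (z - c)"
    using assms by (simp add: power2_norm_eq_inner[symmetric] power_mono)
  then have "bump_profile c r z \<le> 0"
    using assms by (simp add: bump_profile_def)
  then show ?thesis by (simp add: flat_def)
qed

lemma bump_smooth:
  assumes "r > 0"
  shows "bump c r \<in> smooth_compactly_supported"
proof -
  have "{z. bump c r z \<noteq> 0} \<subseteq> cball c r"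
    using bump_eq_0[OF assms, of _ c 0] unfolding bump_def
    by (force simp: dist_norm norm_minus_commute)
  then have "closure {z. bump c r z \<noteq> 0} \<subseteq> cball c r"
    by (rule closure_minimal) simp
  then have "compact (closure {z. bump c r z \<noteq> 0})"
    by (meson bounded_cball bounded_subset closed_closure compact_eq_bounded_closed)
  moreover have "continuously_differentiable n (bump c r)" for n
    using bump_algebra_smooth[OF bump_algebra.flat[of c r 0]] by (simp add: bump_def[abs_def])
  ultimately show ?thesis by (simp add: smooth_compactly_supported_def)
qed

lemma bump_lower:
  assumes "r > 0" "norm (z - c) \<le> r / 2"
  shows "exp (- 2) \<le> bump c r z"
proof -
  have "(z - c) \<bullet> (z - c) \<le> (r / 2)\<^sup>2"
    using assms by (simp add: power2_norm_eq_inner[symmetric] power_mono)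
  then have "4 * ((z - c) \<bullet> (z - c)) \<le> r\<^sup>2"
    by (simp add: power_divide)
  then have "2 * ((z - c) \<bullet> (z - c)) \<le> r\<^sup>2"
    using inner_ge_zero[of "z - c"] by linarith
  then have "bump_profile c r z \<ge> 1 / 2"
    using assms by (simp add: bump_profile_def field_simps)
  then show ?thesis by (simp add: bump_def flat_def field_simps)
qed

text \<open>
  The gradient is \<open>- 2 flat 2 (\<dots>) (z - c) / r\<^sup>2\<close>, where \<open>flat 2 \<le> 2\<close> and \<open>\<bar>z - c\<bar> \<le> r\<close>.
\<close>
lemma norm_gradient_bump:
  assumes "r > 0"
  shows "norm (gradient (bump c r) z) \<le> 4 / r * indicator (cball c r) z"
proof -
  let ?k = "flat 2 (bump_profile c r z) * (- 2 / r\<^sup>2)"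
  have "frechet_derivative (bump c r) (at z) = (\<lambda>h. ?k * (h \<bullet> (z - c)))"
    using frechet_derivative_at[OF flat_profile_has_derivative[of 0 c r z]]
    by (simp add: bump_def[abs_def] mult.assoc numeral_2_eq_2)
  then have "gradient (bump c r) z = (\<Sum>e\<in>Basis. (?k * (e \<bullet> (z - c))) *\<^sub>R e)"
    by (simp add: gradient_def)
  also have "\<dots> = ?k *\<^sub>R (\<Sum>e\<in>Basis. ((z - c) \<bullet> e) *\<^sub>R e)"
    by (simp add: scaleR_sum_right inner_commute)
  also have "\<dots> = ?k *\<^sub>R (z - c)"
    by (simp only: euclidean_representation)
  finally have g: "gradient (bump c r) z = ?k *\<^sub>R (z - c)" .
  show ?thesis
  proof (cases "z \<in> cball c r")
    case True
    then have "norm (z - c) \<le> r" by (simp add: dist_norm norm_minus_commute)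
    then have "norm (gradient (bump c r) z) \<le> (2 * (2 / r\<^sup>2)) * r"
      unfolding g norm_scaleR abs_mult using flat_2_le flat_nonneg[of 2]
      by (intro mult_mono) auto
    also have "\<dots> = 4 / r" using assms by (simp add: power2_eq_square)
    finally show ?thesis using True by simp
  next
    case False
    then show ?thesis using bump_eq_0[OF assms, of z c 2] by (simp add: g dist_norm norm_minus_commute)
  qed
qed

section \<open>Positivity of the best constant\<close>

text \<open>
  The case \<open>\<gamma> > b\<close> reduces to \<open>\<gamma> = b\<close>: replacing \<open>(a, b)\<close> by \<open>(a + \<gamma> - b, \<gamma>)\<close> changes neither the
  potential term nor the two conditions of the Hardy inequality, and decreases the gradient term
  because \<open>\<bar>y\<bar> \<le> \<bar>z\<bar>\<close>.
\<close>
lemma best_constant_pos: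
  fixes p a b \<gamma> :: real
  assumes p: "p > 1" and db: "CARD('k::finite) + CARD('m::finite) + a - p > b"
    and kb: "CARD('k) + a - p > b - \<gamma>" and \<gamma>: "\<gamma> \<ge> b"
  shows "best_constant TYPE('k) TYPE('m) p a b \<gamma> > 0"
proof -
  define \<alpha> where "\<alpha> = a - p - b + \<gamma>"
  obtain C where C: "C > 0" and Hardy: "\<And>u :: (real^'k) \<times> (real^'m) \<Rightarrow> real.
      \<lbrakk>u differentiable_on UNIV; continuous_on UNIV (gradient u); compact (closure {z. u z \<noteq> 0})\<rbrakk> \<Longrightarrow>
      (\<integral>\<^sup>+z. ennreal (weight \<alpha> \<gamma> z * \<bar>u z\<bar> powr p) \<partial>lborel) \<le>
      ennreal C * (\<integral>\<^sup>+z. ennreal (weight \<alpha> \<gamma> z * norm (fst z) powr p * norm (gradient u z) powr p) \<partial>lborel)"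
    using weighted_Hardy[where 'a="real^'k" and 'b="real^'m", of p \<alpha> \<gamma>] p db kb by (auto simp: \<alpha>_def)
  have weight_le: "weight \<alpha> \<gamma> z * norm (fst z) powr p \<le> norm (fst z) powr a * norm z powr (- b)"
    for z :: "(real^'k) \<times> (real^'m)"
  proof (cases "fst z = 0")
    case False
    then have z: "0 < norm (fst z)" "0 < norm z" by (auto simp: prod_eq_iff)
    have "weight \<alpha> \<gamma> z * norm (fst z) powr p = norm (fst z) powr a * norm z powr (- \<gamma>) * norm (fst z) powr (\<gamma> - b)"
      by (simp add: weight_def \<alpha>_def algebra_simps flip: powr_add)
    also have "\<dots> \<le> norm (fst z) powr a * norm z powr (- \<gamma>) * norm z powr (\<gamma> - b)"
      using \<gamma> by (intro mult_left_mono powr_mono2 norm_fst_le_norm) auto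
    also have "\<dots> = norm (fst z) powr a * norm z powr (- b)"
      by (simp add: mult.assoc flip: powr_add)
    finally show ?thesis .
  qed (simp add: weight_def)
  have "admissible_constant TYPE('k) TYPE('m) p a b \<gamma> (ennreal (1 / C))"
    unfolding admissible_constant_def
  proof
    fix u :: "(real^'k) \<times> (real^'m) \<Rightarrow> real"
    assume "u \<in> smooth_compactly_supported"
    then have smooth: "continuously_differentiable (Suc 0) u" and supp: "compact (closure {z. u z \<noteq> 0})"
      by (auto simp only: smooth_compactly_supported_def mem_Collect_eq)
    have cg: "continuous_on UNIV (gradient u)"
      unfolding gradient_def[abs_def] using smooth by (intro continuous_intros) auto
    have "potential_integral p a b \<gamma> u = (\<integral>\<^sup>+z. ennreal (weight \<alpha> \<gamma> z * \<bar>u z\<bar> powr p) \<partial>lborel)"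
      by (simp add: potential_integral_def weight_def \<alpha>_def)
    also have "\<dots> \<le> ennreal C * (\<integral>\<^sup>+z. ennreal (weight \<alpha> \<gamma> z * norm (fst z) powr p * norm (gradient u z) powr p) \<partial>lborel)"
      using smooth by (intro Hardy cg supp) auto
    also have "\<dots> \<le> ennreal C * gradient_integral p a b u"
      unfolding gradient_integral_def
      by (intro mult_left_mono nn_integral_mono ennreal_leI mult_right_mono weight_le) auto
    finally have "ennreal (1 / C) * potential_integral p a b \<gamma> u \<le> ennreal (1 / C) * (ennreal C * gradient_integral p a b u)"
      by (intro mult_left_mono) auto
    also have "\<dots> = gradient_integral p a b u"
      using C by (simp add: mult.assoc[symmetric] flip: ennreal_mult)
    finally show "ennreal (1 / C) * potential_integral p a b \<gamma> u \<le> gradient_integral p a b u" .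
  qed
  then have "ennreal (1 / C) \<le> best_constant TYPE('k) TYPE('m) p a b \<gamma>"
    by (rule admissible_le_best_constant)
  then show ?thesis using C by (meson ennreal_less_zero_iff less_le_trans zero_less_divide_1_iff)
qed

text \<open>
  Near a point \<open>(0, x\<^sub>0)\<close> with \<open>x\<^sub>0 \<noteq> 0\<close> only the powers of \<open>\<bar>y\<bar>\<close> matter. A bump of radius \<open>r\<close> whose
  centre has distance \<open>2 r\<close> from \<open>y = 0\<close> sees \<open>\<bar>y\<bar> \<approx> r\<close> and \<open>\<bar>z\<bar> \<approx> 1\<close>, so that the quotient
  is of order \<open>r powr (b - \<gamma>)\<close>, and this tends to 0 when \<open>\<gamma> < b\<close>.
\<close>
lemma best_constant_zero:
  fixes p a b \<gamma> :: real
  assumes p: "p > 1" and \<gamma>: "\<gamma> < b"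
  shows "best_constant TYPE('k::finite) TYPE('m::finite) p a b \<gamma> = 0"
proof (rule ccontr)
  let ?S = "best_constant TYPE('k) TYPE('m) p a b \<gamma>" and ?d = "DIM((real^'k) \<times> (real^'m))"
  assume "?S \<noteq> 0"
  obtain s where s: "s > 0" "ennreal s \<le> ?S"
  proof (cases "?S")
    case (real x)
    then show ?thesis using that[of x] \<open>?S \<noteq> 0\<close> by (auto simp: less_le)
  next
    case top
    then show ?thesis using that[of 1] by simp
  qed
  have quotient: "ennreal s * potential_integral p a b \<gamma> u \<le> gradient_integral p a b u"
    if "u \<in> smooth_compactly_supported" for u :: "(real^'k) \<times> (real^'m) \<Rightarrow> real"
    using admissible_best_constant[of "TYPE('k)" "TYPE('m)" p a b \<gamma>] that s(2)
    unfolding admissible_constant_def by (meson mult_right_mono order_trans zero_le)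
  define \<alpha> where "\<alpha> = a - p - b + \<gamma>"
  define \<omega> where "\<omega> = unit_ball_vol ?d"
  have \<omega>: "\<omega> > 0" by (simp add: \<omega>_def unit_ball_vol_pos)
  \<comment> \<open>On the support of the bump, \<open>r \<le> \<bar>y\<bar> \<le> 4 r\<close> and \<open>1 / 2 \<le> \<bar>z\<bar> \<le> 2\<close>, so in either case the
    larger end is 4 times the smaller one.\<close>
  define K1 where "K1 = 4 powr \<bar>a\<bar> * (4 powr \<bar>b\<bar> * (1 / 2) powr (- b)) * 4 powr p * \<omega>"
  define K2 where "K2 = inverse (4 powr \<bar>\<alpha>\<bar>) * (inverse (4 powr \<bar>\<gamma>\<bar>) * (1 / 2) powr (- \<gamma>)) * exp (- 2) powr p * \<omega> / 2 ^ ?d"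
  have K: "K1 > 0" "K2 > 0" using \<omega> by (auto simp: K1_def K2_def)
  have small: "s * K2 \<le> K1 * r powr (b - \<gamma>)" if r: "0 < r" "r \<le> 1 / 4" for r
  proof -
    define c :: "(real^'k) \<times> (real^'m)" where "c = ((2 * r) *\<^sub>R axis undefined 1, axis undefined 1)"
    have c: "norm (fst c) = 2 * r" "norm (snd c) = 1" using r by (auto simp: c_def norm_axis_1)
    have loc: "r \<le> norm (fst z)" "norm (fst z) \<le> 4 * r" "1 / 2 \<le> norm z" "norm z \<le> 4 * (1 / 2)"
      if "z \<in> cball c r" for z
    proof -
      have "norm (z - c) \<le> r" using that by (simp add: dist_norm norm_minus_commute)
      then have 1: "norm (fst z - fst c) \<le> r" "norm (snd z - snd c) \<le> r"
        using norm_fst_le_norm[of "z - c"] norm_snd_le_norm[of "z - c"] by auto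
      show "r \<le> norm (fst z)" using 1(1) c(1) norm_triangle_ineq2[of "fst c" "fst z"] by (simp add: norm_minus_commute)
      show 2: "norm (fst z) \<le> 4 * r" using 1(1) c(1) norm_triangle_ineq2[of "fst z" "fst c"] r by simp
      have "1 - r \<le> norm (snd z)" using 1(2) c(2) norm_triangle_ineq2[of "snd c" "snd z"] by (simp add: norm_minus_commute)
      then show "1 / 2 \<le> norm z" using norm_snd_le_norm[of z] r by linarith
      have "norm z \<le> norm c + r" using norm_triangle_ineq2[of z c] \<open>norm (z - c) \<le> r\<close> by linarith
      also have "\<dots> \<le> 4 * (1 / 2)" using norm_le_fst_snd[of c] c r by linarith
      finally show "norm z \<le> 4 * (1 / 2)" .
    qed
    let ?M1 = "(4 powr \<bar>a\<bar> * r powr a) * (4 powr \<bar>b\<bar> * (1 / 2) powr (- b)) * (4 / r) powr p"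
    have "gradient_integral p a b (bump c r) \<le> ennreal (?M1 * (\<omega> * r ^ ?d))"
      unfolding gradient_integral_def \<omega>_def
    proof (rule nn_integral_le_const_cball[where c = c])
      fix z
      show "norm (fst z) powr a * norm z powr (- b) * norm (gradient (bump c r) z) powr p \<le> ?M1 * indicator (cball c r) z"
      proof (cases "z \<in> cball c r")
        case True
        have "norm (gradient (bump c r) z) \<le> 4 / r"
          using norm_gradient_bump[OF r(1), of c z] True by simp
        then show ?thesis
          using True p r loc[OF True] powr_doubling'[of r "norm (fst z)" 4 a] powr_doubling'[of "1/2" "norm z" 4 "- b"]
          by (simp only: indicator_simps mult_1_right) (intro mult_mono powr_mono2, auto)
      next
        case False
        then have "norm (gradient (bump c r) z) = 0"
          using norm_gradient_bump[OF r(1), of c z] by simp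
        then show ?thesis using False by simp
      qed
    qed (use r in auto)
    also have "?M1 * (\<omega> * r ^ ?d) = K1 * r powr (a - p + ?d)"
      using r by (simp add: K1_def powr_divide powr_diff powr_add powr_realpow power_add field_simps)
    finally have upper: "gradient_integral p a b (bump c r) \<le> ennreal (K1 * r powr (a - p + ?d))" .
    let ?M2 = "(inverse (4 powr \<bar>\<alpha>\<bar>) * r powr \<alpha>) * (inverse (4 powr \<bar>\<gamma>\<bar>) * (1 / 2) powr (- \<gamma>)) * exp (- 2) powr p"
    have "K2 * r powr (\<alpha> + ?d) = ?M2 * (\<omega> * (r / 2) ^ ?d)"
      using r by (simp add: K2_def powr_add powr_realpow power_divide power_add field_simps)
    also have "ennreal \<dots> \<le> potential_integral p a b \<gamma> (bump c r)"
      unfolding potential_integral_def \<omega>_def \<alpha>_def[symmetric]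
    proof (rule nn_integral_ge_const_cball[where c = c])
      fix z assume z: "z \<in> cball c (r / 2)"
      then have z': "z \<in> cball c r" using r by auto
      have "exp (- 2) \<le> \<bar>bump c r z\<bar>"
        using bump_lower[OF r(1), of z c] z by (simp add: dist_norm norm_minus_commute)
      moreover have "inverse (4 powr \<bar>\<alpha>\<bar>) * r powr \<alpha> \<le> norm (fst z) powr \<alpha>"
        using r loc[OF z'] powr_doubling[of r "norm (fst z)" 4 \<alpha>] by (simp add: field_simps)
      moreover have "inverse (4 powr \<bar>\<gamma>\<bar>) * (1 / 2) powr (- \<gamma>) \<le> norm z powr (- \<gamma>)"
        using loc[OF z'] powr_doubling[of "1/2" "norm z" 4 "- \<gamma>"] by (simp add: field_simps)
      ultimately show "?M2 \<le> norm (fst z) powr \<alpha> * norm z powr (- \<gamma>) * \<bar>bump c r z\<bar> powr p"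
        using p by (intro mult_mono powr_mono2) auto
    qed (use r in auto)
    finally have lower: "ennreal (K2 * r powr (\<alpha> + ?d)) \<le> potential_integral p a b \<gamma> (bump c r)" .
    have "ennreal (s * (K2 * r powr (\<alpha> + ?d))) = ennreal s * ennreal (K2 * r powr (\<alpha> + ?d))"
      using s by (simp add: ennreal_mult')
    also have "\<dots> \<le> ennreal s * potential_integral p a b \<gamma> (bump c r)"
      by (intro mult_left_mono lower) auto
    also have "\<dots> \<le> gradient_integral p a b (bump c r)"
      by (rule quotient[OF bump_smooth[OF r(1)]])
    also note upper
    finally have "s * (K2 * r powr (\<alpha> + ?d)) \<le> K1 * r powr (a - p + ?d)"
      using K by (subst (asm) ennreal_le_iff) auto
    also have "\<dots> = K1 * r powr (b - \<gamma>) * r powr (\<alpha> + ?d)"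
      by (simp add: \<alpha>_def mult.assoc add_ac add_diff_eq diff_add_eq flip: powr_add)
    finally show ?thesis using r by (simp add: mult.assoc[symmetric])
  qed
  have "((\<lambda>r. K1 * r powr (b - \<gamma>)) \<longlongrightarrow> K1 * 0) (at_right 0)"
    using \<gamma> by (intro tendsto_mult_left tendsto_zero_powrI[where b = "b - \<gamma>"]) (auto simp: eventually_at_filter)
  then have "\<forall>\<^sub>F r in at_right 0. K1 * r powr (b - \<gamma>) < s * K2"
    using s K by (intro order_tendstoD(2)) auto
  moreover have "\<forall>\<^sub>F r in at_right 0. r \<in> {0<..<1/4::real}"
    by (rule eventually_at_right_real) simp
  ultimately have "\<forall>\<^sub>F r in at_right (0::real). False"
    by eventually_elim (use small in \<open>force\<close>)
  then show False by simp
qed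

theorem theorem1p1:
  fixes d k :: nat and p a b \<gamma> :: real
  assumes "k = CARD('k::finite)" and "d = CARD('k) + CARD('m::finite)"
    and "p > 1"
    and "real k + a > 0"
    and "real d + a - p > b"
    and "real k + a - p > b - \<gamma>"
  shows "best_constant TYPE('k) TYPE('m) p a b \<gamma> > 0 \<longleftrightarrow> \<gamma> \<ge> b"
proof
  assume "best_constant TYPE('k) TYPE('m) p a b \<gamma> > 0"
  then show "\<gamma> \<ge> b"
    using best_constant_zero[OF \<open>p > 1\<close>, of \<gamma> b] by (metis less_irrefl not_le)
next
  assume "\<gamma> \<ge> b"
  then show "best_constant TYPE('k) TYPE('m) p a b \<gamma> > 0"
    using assms by (intro best_constant_pos) auto
qed

end
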